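(* Let $K\ge 1$ and let $f=u+iv$ be a harmonic $K$-quasiregular mapping in $\mathbb{D}$ (with $u,v$ real-valued) such that $u\ge 1$ in $\mathbb{D}$ (or $u\le -1$ in $\mathbb{D}$) and $v(0)=0$. If $u\in \mathbf{h}\log^+\mathbf{h}$, then $f\in h^1$ and, for every $r\in(0,1)$, $$M_1(r,f)\le \frac{K^2}{2\pi}\int_0^{2\pi}|u(re^{i\theta})|\log^+|u(re^{i\theta})|\,d\theta+|u(0)|\left[1-K^2\log|u(0)|\right].$$ Consequently, $v\in h^1$ and, for every $r\in(0,1)$, $$M_1(r,v)\le \frac{K^2}{2\pi}\int_0^{2\pi}|u(re^{i\theta})|\log^+|u(re^{i\theta})|\,d\theta+|u(0)|\left[1-K^2\log|u(0)|\right].$$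
   Context: $\mathbb{D}=\{z\in\mathbb{C}:|z|<1\}$. A complex-valued function $f=u+iv$ is harmonic in $\mathbb{D}$ if $u,v$ are real-valued harmonic functions in $\mathbb{D}$; every such $f$ can be written $f=h+\overline{g}$ with $h,g$ analytic in $\mathbb{D}$, uniquely under the normalization $g(0)=0$. For $K\ge1$, a sense-preserving harmonic function $f=h+\overline g$ is $K$-quasiregular if its complex dilatation $\omega=g'/h'$ satisfies $|\omega(z)|\le k<1$ for all $z\in\mathbb{D}$, where $k=\frac{K-1}{K+1}$ (removable singularities of $\omega$ at zeros of $h'$ being removed). For $0<p<\infty$, $M_p(r,f)=\left(\frac1{2\pi}\int_0^{2\pi}|f(re^{i\theta})|^p\,d\theta\right)^{1/p}$, and $h^p$ is the class of functions $f$ harmonic in $\mathbb{D}$ with $\lim_{r\to1^-}M_p(r,f)<\infty$. $\log^+x=\max\{\log x,0\}$. The class $\mathbf{h}\log^+\mathbf{h}$ consists of the real-valued harmonic functions $u$ in $\mathbb{D}$ for which the integrals $\int_0^{2\pi}|u(re^{i\theta})|\log^+|u(re^{i\theta})|\,d\theta$ are bounded for $0<r<1$. *)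

theory Defs
  imports "HOL-Complex_Analysis.Complex_Analysis"
begin

abbreviation unit_disc :: "complex set" where
  "unit_disc \<equiv> ball 0 1"

definition partial_x :: "(complex \<Rightarrow> real) \<Rightarrow> complex \<Rightarrow> real" where
  "partial_x u z = deriv (\<lambda>t::real. u (z + of_real t)) 0"

definition partial_y :: "(complex \<Rightarrow> real) \<Rightarrow> complex \<Rightarrow> real" where
  "partial_y u z = deriv (\<lambda>t::real. u (z + \<i> * of_real t)) 0"

definition C1_on :: "complex set \<Rightarrow> (complex \<Rightarrow> real) \<Rightarrow> bool" where
  "C1_on S u \<longleftrightarrow>
     (\<forall>z\<in>S. (\<lambda>t::real. u (z + of_real t)) field_differentiable at 0 \<and>
            (\<lambda>t::real. u (z + \<i> * of_real t)) field_differentiable at 0) \<and>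
     continuous_on S (partial_x u) \<and> continuous_on S (partial_y u)"

definition C2_on :: "complex set \<Rightarrow> (complex \<Rightarrow> real) \<Rightarrow> bool" where
  "C2_on S u \<longleftrightarrow> C1_on S u \<and> C1_on S (partial_x u) \<and> C1_on S (partial_y u)"

definition real_harmonic_on :: "complex set \<Rightarrow> (complex \<Rightarrow> real) \<Rightarrow> bool" where
  "real_harmonic_on S u \<longleftrightarrow>
     C2_on S u \<and> (\<forall>z\<in>S. partial_x (partial_x u) z + partial_y (partial_y u) z = 0)"

definition harmonic_on :: "complex set \<Rightarrow> (complex \<Rightarrow> complex) \<Rightarrow> bool" where
  "harmonic_on S f \<longleftrightarrow>
     real_harmonic_on S (\<lambda>z. Re (f z)) \<and> real_harmonic_on S (\<lambda>z. Im (f z))"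

definition canonical_decomposition ::
    "(complex \<Rightarrow> complex) \<Rightarrow> (complex \<Rightarrow> complex) \<Rightarrow> (complex \<Rightarrow> complex) \<Rightarrow> bool" where
  "canonical_decomposition f h g \<longleftrightarrow>
     h holomorphic_on unit_disc \<and> g holomorphic_on unit_disc \<and> g 0 = 0 \<and>
     (\<forall>z\<in>unit_disc. f z = h z + cnj (g z))"

definition complex_dilatation ::
    "(complex \<Rightarrow> complex) \<Rightarrow> (complex \<Rightarrow> complex) \<Rightarrow> complex \<Rightarrow> complex" where
  "complex_dilatation h g = remove_sings (\<lambda>z. deriv g z / deriv h z)"

text \<open>
  Sense-preserving harmonic functions may have critical points: \<open>h'\<close> may have zeros, as long as it
  does not vanish identically and the dilatation extends analytically across them. Analyticity is
  required explicitly because \<^const>\<open>remove_sings\<close> takes the value 0 at a pole.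
\<close>
definition sense_preserving ::
    "(complex \<Rightarrow> complex) \<Rightarrow> (complex \<Rightarrow> complex) \<Rightarrow> bool" where
  "sense_preserving h g \<longleftrightarrow>
     (\<exists>z\<in>unit_disc. deriv h z \<noteq> 0) \<and>
     complex_dilatation h g holomorphic_on unit_disc \<and>
     (\<forall>z\<in>unit_disc. norm (complex_dilatation h g z) < 1)"

definition harmonic_quasiregular :: "real \<Rightarrow> (complex \<Rightarrow> complex) \<Rightarrow> bool" where
  "harmonic_quasiregular K f \<longleftrightarrow>
     harmonic_on unit_disc f \<and>
     (\<exists>h g. canonical_decomposition f h g \<and> sense_preserving h g \<and>
        (\<forall>z\<in>unit_disc. norm (complex_dilatation h g z) \<le> (K - 1) / (K + 1)))"

definition integral_mean :: "real \<Rightarrow> real \<Rightarrow> (complex \<Rightarrow> complex) \<Rightarrow> real" where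
  "integral_mean p r f =
     (1 / (2 * pi) * integral {0..2*pi} (\<lambda>\<theta>. norm (f (of_real r * cis \<theta>)) powr p)) powr (1 / p)"

definition hardy_harmonic :: "real \<Rightarrow> (complex \<Rightarrow> complex) set" where
  "hardy_harmonic p =
     {f. harmonic_on unit_disc f \<and> (\<exists>L. ((\<lambda>r. integral_mean p r f) \<longlongrightarrow> L) (at_left 1))}"

definition log_plus :: "real \<Rightarrow> real" where
  "log_plus x = max (ln x) 0"

definition llog_integral :: "(complex \<Rightarrow> real) \<Rightarrow> real \<Rightarrow> real" where
  "llog_integral u r =
     integral {0..2*pi} (\<lambda>\<theta>. \<bar>u (of_real r * cis \<theta>)\<bar> * log_plus \<bar>u (of_real r * cis \<theta>)\<bar>)"

definition h_log_h :: "(complex \<Rightarrow> real) set" where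
  "h_log_h = {u. real_harmonic_on unit_disc u \<and> bounded (llog_integral u ` {0<..<1})}"

end

theory Submission
  imports Defs
begin

text \<open>
  With \<open>f = h + cnj g\<close>, \<open>p = h + g\<close> and \<open>q = h - g\<close> one has \<open>u = Re p\<close> and \<open>v = Im q\<close>.
  Where \<open>u > 0\<close>, the Laplacian of \<open>u ln u\<close> is \<open>|p'|\<^sup>2 / u\<close> and that of \<open>|f|\<close> is
  \<open>|u q' - i v p'|\<^sup>2 / |f|\<^sup>3\<close>. Since \<open>u q' - i v p' = cnj f h' - f g'\<close>, quasiregularity bounds the
  latter by \<open>K\<^sup>2 |p'|\<^sup>2 / |f|\<close>, so \<open>K\<^sup>2 u ln u - |f|\<close> is subharmonic; comparing its mean over the circle
  of radius \<open>r\<close> with its value at 0 is the estimate for \<open>f\<close>. The circle means of the subharmonic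
  functions \<open>|f|\<close> and \<open>|v|\<close> increase with \<open>r\<close>, hence converge as soon as they are bounded.

  Monotonicity of circle means is obtained in the coordinate \<open>w = s + i t = log z\<close>: the mean is a
  function of \<open>s < 0\<close> whose second derivative is the mean of the Laplacian (the \<open>t\<close>-part integrates to
  zero by periodicity), and a convex function bounded near \<open>-\<infinity>\<close> is nondecreasing.
\<close>

section \<open>Means over vertical segments in the left half-plane\<close>

text \<open>In the application \<open>G1\<close> and \<open>G2\<close> are the first and second
  t-derivatives of \<open>F\<close>. They enter only through the integral of \<open>G2\<close> over
  a period, which \<open>periodic\<close> makes zero. An upper bound as s tends to minus infinity
  suffices, because a convex function with a negative slope somewhere grows without bound to the
  left.\<close>

lemma halfplane_mean_mono:
  fixes F F1 F2 G1 G2 :: "complex \<Rightarrow> real" and a B :: real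
  defines "M \<equiv> \<lambda>s. integral {0..2*pi} (\<lambda>t. F (Complex s t))"
  assumes F1: "\<And>s t. s < 0 \<Longrightarrow> ((\<lambda>s. F (Complex s t)) has_real_derivative F1 (Complex s t)) (at s)"
    and F2: "\<And>s t. s < 0 \<Longrightarrow> ((\<lambda>s. F1 (Complex s t)) has_real_derivative F2 (Complex s t)) (at s)"
    and G2: "\<And>s t. s < 0 \<Longrightarrow> ((\<lambda>t. G1 (Complex s t)) has_real_derivative G2 (Complex s t)) (at t)"
    and periodic: "\<And>s. s < 0 \<Longrightarrow> G1 (Complex s (2*pi)) = G1 (Complex s 0)"
    and cont: "continuous_on {w. Re w < 0} F" "continuous_on {w. Re w < 0} F1"
      "continuous_on {w. Re w < 0} F2"
    and laplacian: "\<And>w. Re w < 0 \<Longrightarrow> 0 \<le> F2 w + G2 w"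
    and bounded: "\<And>s. s \<le> a \<Longrightarrow> M s \<le> B"
    and le: "s \<le> t" "t < 0"
  shows "M s \<le> M t"
proof -
  have cont_pair: "continuous_on ({..<0} \<times> cbox 0 (2*pi)) (\<lambda>(s, t). X (Complex s t))"
    and integrable: "s < 0 \<Longrightarrow> (\<lambda>t. X (Complex s t)) integrable_on cbox 0 (2*pi)"
    if "continuous_on {w. Re w < 0} X" for X :: "complex \<Rightarrow> real" and s
    unfolding split_def Complex_eq
    by (intro continuous_on_compose2[OF that] integrable_continuous continuous_intros; force)+
  define M1 where "M1 s = integral {0..2*pi} (\<lambda>t. F1 (Complex s t))" for s
  define M2 where "M2 s = integral {0..2*pi} (\<lambda>t. F2 (Complex s t))" for s
  have DM: "(M has_real_derivative M1 s) (at s)" if "s < 0" for s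
  proof -
    have "((\<lambda>s. integral (cbox 0 (2*pi)) (\<lambda>t. F (Complex s t))) has_real_derivative
        integral (cbox 0 (2*pi)) (\<lambda>t. F1 (Complex s t))) (at s within {..<0})"
      using that by (intro leibniz_rule_field_derivative cont_pair cont integrable)
        (auto intro: DERIV_subset[OF F1])
    with that show ?thesis
      by (simp add: M_def M1_def at_within_open[of s "{..<0}"])
  qed
  have DM1: "(M1 has_real_derivative M2 s) (at s)" if "s < 0" for s
  proof -
    have "((\<lambda>s. integral (cbox 0 (2*pi)) (\<lambda>t. F1 (Complex s t))) has_real_derivative
        integral (cbox 0 (2*pi)) (\<lambda>t. F2 (Complex s t))) (at s within {..<0})"
      using that by (intro leibniz_rule_field_derivative cont_pair cont integrable)
        (auto intro: DERIV_subset[OF F2])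
    with that show ?thesis
      by (simp add: M1_def[abs_def] M2_def at_within_open[of s "{..<0}"])
  qed
  \<comment> \<open>The t-part integrates to zero, so \<open>M2 s\<close> equals the integral of the
    whole Laplacian.\<close>
  have M2_nonneg: "0 \<le> M2 s" if "s < 0" for s
  proof -
    have "((\<lambda>t. G2 (Complex s t)) has_integral (G1 (Complex s (2*pi)) - G1 (Complex s 0))) {0..2*pi}"
      using G2[OF that] by (intro fundamental_theorem_of_calculus)
        (auto simp: has_real_derivative_iff_has_vector_derivative[symmetric] intro: DERIV_subset)
    then have "((\<lambda>t. G2 (Complex s t)) has_integral 0) {0..2*pi}"
      using periodic[OF that] by simp
    moreover have "((\<lambda>t. F2 (Complex s t)) has_integral M2 s) {0..2*pi}"
      using integrable[OF cont(3) that] by (simp add: M2_def integrable_integral)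
    ultimately have "((\<lambda>t. F2 (Complex s t) + G2 (Complex s t)) has_integral (M2 s + 0)) {0..2*pi}"
      by (rule has_integral_add[rotated])
    from has_integral_nonneg[OF this] show ?thesis using laplacian that by simp
  qed
  have M1_mono: "M1 x \<le> M1 y" if "x \<le> y" "y < 0" for x y
    by (rule DERIV_nonneg_imp_nondecreasing[OF that(1)])
      (use DM1 M2_nonneg that in \<open>meson order.strict_trans1\<close>)
  have M1_nonneg: "0 \<le> M1 x" if "x < 0" for x
  proof (rule ccontr)
    assume neg: "\<not> 0 \<le> M1 x"
    \<comment> \<open>Slopes to the left of \<open>x\<close> are at most \<open>M1 x\<close>, so
      \<open>M\<close> stays above its tangent at \<open>x\<close>.\<close>
    have below: "M x + M1 x * (y - x) \<le> M y" if "y \<le> x" for y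
    proof -
      have "(\<lambda>z. M1 x * z - M z) y \<le> (\<lambda>z. M1 x * z - M z) x"
      proof (rule DERIV_nonneg_imp_nondecreasing[OF that])
        fix z assume "y \<le> z" "z \<le> x"
        with \<open>x < 0\<close> have "z < 0" "M1 z \<le> M1 x" by (auto intro: M1_mono)
        have "((\<lambda>z. M1 x * z - M z) has_real_derivative M1 x - M1 z) (at z)"
          using DERIV_diff[OF DERIV_cmult_Id DM[OF \<open>z < 0\<close>]] .
        with \<open>M1 z \<le> M1 x\<close>
        show "\<exists>D. ((\<lambda>z. M1 x * z - M z) has_real_derivative D) (at z) \<and> 0 \<le> D" by auto
      qed
      then show ?thesis by (simp add: algebra_simps)
    qed
    \<comment> \<open>So far to the left that the tangent has reached at least B + 1; the minimum
      also keeps \<open>y\<close> in the range of \<open>below\<close> and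
      \<open>bounded\<close>.\<close>
    define y where "y = min (min a x) (x + (B - M x + 1) / M1 x)"
    have "y - x \<le> (B - M x + 1) / M1 x" by (simp add: y_def)
    then have "B - M x + 1 \<le> M1 x * (y - x)"
      using neg by (simp add: field_simps)
    moreover have "y \<le> x" "y \<le> a" by (simp_all add: y_def)
    ultimately show False using below[of y] bounded[of y] by simp
  qed
  show ?thesis
    by (rule DERIV_nonneg_imp_nondecreasing[OF le(1)])
      (use DM M1_nonneg le in \<open>meson order.strict_trans1\<close>)
qed

section \<open>The comparison function and its Laplacian\<close>

text \<open>
  The pair \<open>(c, d) = (K\<^sup>2, 1)\<close> serves for the main estimate and \<open>(0, -1)\<close> for the means of \<open>|f|\<close>. The
  primed versions are the derivatives along a line, with \<open>a1, b1, a2, b2\<close> standing for the first and second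
  derivatives of \<open>a\<close> and \<open>b\<close>.
\<close>

definition llog_norm :: "real \<Rightarrow> real \<Rightarrow> real \<Rightarrow> real \<Rightarrow> real" where
  "llog_norm c d a b = c * (a * ln a) - d * sqrt (a\<^sup>2 + b\<^sup>2)"

definition llog_norm' :: "real \<Rightarrow> real \<Rightarrow> real \<Rightarrow> real \<Rightarrow> real \<Rightarrow> real \<Rightarrow> real" where
  "llog_norm' c d a b a1 b1 = c * ((ln a + 1) * a1) - d * ((a * a1 + b * b1) / sqrt (a\<^sup>2 + b\<^sup>2))"

definition llog_norm'' :: "real \<Rightarrow> real \<Rightarrow> real \<Rightarrow> real \<Rightarrow> real \<Rightarrow> real \<Rightarrow> real \<Rightarrow> real \<Rightarrow> real" where
  "llog_norm'' c d a b a1 b1 a2 b2 = c * (a1\<^sup>2 / a + (ln a + 1) * a2)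
     - d * ((a1\<^sup>2 + b1\<^sup>2 + a * a2 + b * b2) / sqrt (a\<^sup>2 + b\<^sup>2)
            - (a * a1 + b * b1)\<^sup>2 / sqrt (a\<^sup>2 + b\<^sup>2) ^ 3)"

lemma has_real_derivative_sqrt_sum_squares:
  assumes "(a has_real_derivative a1) (at t)" "(b has_real_derivative b1) (at t)" "a t > 0"
  shows "((\<lambda>t. sqrt ((a t)\<^sup>2 + (b t)\<^sup>2)) has_real_derivative
    (a t * a1 + b t * b1) / sqrt ((a t)\<^sup>2 + (b t)\<^sup>2)) (at t)"
proof -
  have "(a t)\<^sup>2 + (b t)\<^sup>2 > 0" using assms(3) by (simp add: add_pos_nonneg)
  with assms show ?thesis
    by (auto intro!: derivative_eq_intros simp: field_simps)
qed

lemma llog_norm_deriv: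
  assumes "(a has_real_derivative a1) (at t)" "(b has_real_derivative b1) (at t)" "a t > 0"
  shows "((\<lambda>t. llog_norm c d (a t) (b t)) has_real_derivative llog_norm' c d (a t) (b t) a1 b1) (at t)"
  unfolding llog_norm_def llog_norm'_def
  by (rule has_real_derivative_sqrt_sum_squares derivative_eq_intros assms refl)+
    (use assms(3) in \<open>simp add: field_simps\<close>)

lemma llog_norm'_deriv:
  assumes "(a has_real_derivative a1 t) (at t)" "(b has_real_derivative b1 t) (at t)" "a t > 0"
    and "(a1 has_real_derivative a2) (at t)" "(b1 has_real_derivative b2) (at t)"
  shows "((\<lambda>t. llog_norm' c d (a t) (b t) (a1 t) (b1 t)) has_real_derivative
    llog_norm'' c d (a t) (b t) (a1 t) (b1 t) a2 b2) (at t)"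
proof -
  define S where "S t = sqrt ((a t)\<^sup>2 + (b t)\<^sup>2)" for t
  define N where "N t = a t * a1 t + b t * b1 t" for t
  have "(a t)\<^sup>2 + (b t)\<^sup>2 > 0" using assms(3) by (simp add: add_pos_nonneg)
  then have S: "S t > 0" by (simp add: S_def)
  have DS: "(S has_real_derivative N t / S t) (at t)"
    unfolding S_def N_def using has_real_derivative_sqrt_sum_squares[OF assms(1-3)] .
  have DN: "(N has_real_derivative (a1 t)\<^sup>2 + (b1 t)\<^sup>2 + a t * a2 + b t * b2) (at t)"
    unfolding N_def by (rule derivative_eq_intros assms refl)+ (simp add: power2_eq_square algebra_simps)
  have "((\<lambda>t. N t / S t) has_real_derivative
      ((a1 t)\<^sup>2 + (b1 t)\<^sup>2 + a t * a2 + b t * b2) / S t - (N t)\<^sup>2 / S t ^ 3) (at t)"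
    by (rule derivative_eq_intros DS DN refl)+
      (use S in \<open>simp_all add: field_simps power2_eq_square power3_eq_cube\<close>)
  moreover have "((\<lambda>t. (ln (a t) + 1) * a1 t) has_real_derivative
      (a1 t)\<^sup>2 / a t + (ln (a t) + 1) * a2) (at t)"
    by (rule derivative_eq_intros assms refl)+
      (use assms(3) in \<open>simp add: field_simps power2_eq_square\<close>)
  ultimately show ?thesis
    unfolding llog_norm'_def llog_norm''_def S_def[symmetric] N_def[symmetric]
    by (intro DERIV_diff DERIV_cmult)
qed

text \<open>
  The second-order data in the direction \<open>i\<close> are the negatives of those in the direction \<open>1\<close>, as the
  second derivative picks up the factor \<open>i\<^sup>2\<close>.
\<close>

lemma llog_norm''_laplacian:
  assumes "a > 0"
  shows "llog_norm'' c d a b (Re p1) (Im q1) (Re p2) (Im q2)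
      + llog_norm'' c d a b (Re (\<i> * p1)) (Im (\<i> * q1)) (- Re p2) (- Im q2)
    = c * (norm p1)\<^sup>2 / a
      - d * (norm (of_real a * q1 - \<i> * of_real b * p1))\<^sup>2 / sqrt (a\<^sup>2 + b\<^sup>2) ^ 3"
proof -
  define S where "S = sqrt (a\<^sup>2 + b\<^sup>2)"
  have pos: "a\<^sup>2 + b\<^sup>2 > 0" using assms by (simp add: add_pos_nonneg)
  then have S: "S > 0" and S2: "a\<^sup>2 + b\<^sup>2 = S\<^sup>2" by (simp_all add: S_def)
  define X where "X = (Re p1)\<^sup>2 + (Im q1)\<^sup>2 + (Im p1)\<^sup>2 + (Re q1)\<^sup>2"
  define N where "N = (norm (of_real a * q1 - \<i> * of_real b * p1))\<^sup>2"
  define Y Z where "Y = (a * Re p1 + b * Im q1)\<^sup>2" and "Z = (- a * Im p1 + b * Re q1)\<^sup>2"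
  \<comment> \<open>Lagrange's identity for (a, b) paired with (Re p1, Im q1) and with (-Im p1, Re
    q1). The dot products give \<open>Y\<close> and \<open>Z\<close>; the two cross terms are the
    imaginary and real parts of a q1 - i b p1, whose squares sum to \<open>N\<close>.\<close>
  have "(a\<^sup>2 + b\<^sup>2) * X = N + Y + Z"
    unfolding cmod_power2 X_def N_def Y_def Z_def by (simp add: power2_eq_square algebra_simps)
  then have eq: "X / S = N / S^3 + Y / S^3 + Z / S^3"
    using S unfolding S2 by (simp add: field_simps power2_eq_square power3_eq_cube)
  have "llog_norm'' c d a b (Re p1) (Im q1) (Re p2) (Im q2)
      + llog_norm'' c d a b (Re (\<i> * p1)) (Im (\<i> * q1)) (- Re p2) (- Im q2)
    = c * (norm p1)\<^sup>2 / a - d * (X / S - Y / S^3 - Z / S^3)"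
    unfolding llog_norm''_def S_def[symmetric] cmod_power2 X_def Y_def Z_def
    by (simp add: add_divide_distrib diff_divide_distrib algebra_simps)
  then show ?thesis unfolding eq N_def S_def[symmetric] by simp
qed

section \<open>Monotonicity of circle means in the disc\<close>

text \<open>The hypothesis \<open>laplacian\<close> says that \<open>llog_norm c d\<close> of Re p
  and Im q is subharmonic. Pulling back by exp turns circles into vertical segments of length 2 pi.
  The centre corresponds to s at minus infinity and is reached by a limit.\<close>

lemma circle_mean_mono:
  fixes p q :: "complex \<Rightarrow> complex" and c d :: real
  defines "m \<equiv> \<lambda>r. integral {0..2*pi} (\<lambda>t. llog_norm c d (Re (p (of_real r * cis t))) (Im (q (of_real r * cis t))))"
  assumes holo: "p holomorphic_on ball 0 1" "q holomorphic_on ball 0 1"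
    and pos: "\<And>z. norm z < 1 \<Longrightarrow> Re (p z) > 0"
    and laplacian: "\<And>z. norm z < 1 \<Longrightarrow>
      d * (norm (of_real (Re (p z)) * deriv q z - \<i> * of_real (Im (q z)) * deriv p z))\<^sup>2
        / sqrt ((Re (p z))\<^sup>2 + (Im (q z))\<^sup>2) ^ 3 \<le> c * (norm (deriv p z))\<^sup>2 / Re (p z)"
    and le: "0 \<le> r" "r \<le> R" "R < 1"
  shows "m r \<le> m R"
proof -
  \<comment> \<open>\<open>X p\<close> is the pullback of \<open>p\<close> by exp, and
    \<open>X1 p\<close>, \<open>X2 p\<close> are its first two complex derivatives.\<close>
  define X where "X p w = p (exp w)" for p :: "complex \<Rightarrow> complex" and w
  define X1 where "X1 p w = deriv p (exp w) * exp w" for p :: "complex \<Rightarrow> complex" and w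
  define X2 where "X2 p w = deriv (deriv p) (exp w) * (exp w)\<^sup>2 + deriv p (exp w) * exp w"
    for p :: "complex \<Rightarrow> complex" and w
  have DX: "(X p has_field_derivative X1 p w) (at w)"
    and DX1: "(X1 p has_field_derivative X2 p w) (at w)"
    if "p holomorphic_on ball 0 1" "Re w < 0" for p w
  proof -
    have w: "exp w \<in> ball 0 1" using that by simp
    have D: "(p has_field_derivative deriv p (exp w)) (at (exp w))"
      by (rule holomorphic_derivI[OF that(1) open_ball w])
    have D1: "(deriv p has_field_derivative deriv (deriv p) (exp w)) (at (exp w))"
      by (rule holomorphic_derivI[OF holomorphic_deriv[OF that(1) open_ball] open_ball w])
    show "(X p has_field_derivative X1 p w) (at w)"
      unfolding X_def X1_def by (rule DERIV_chain2[where f = p and g = exp, OF D DERIV_exp])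
    show "(X1 p has_field_derivative X2 p w) (at w)"
      unfolding X1_def X2_def
      using DERIV_mult[OF DERIV_chain2[where f = "deriv p" and g = exp, OF D1 DERIV_exp] DERIV_exp]
      by (simp add: power2_eq_square ac_simps)
  qed
  have contX: "continuous_on {w. Re w < 0} (X p)" "continuous_on {w. Re w < 0} (X1 p)"
    "continuous_on {w. Re w < 0} (X2 p)" if "p holomorphic_on ball 0 1" for p
  proof -
    have p': "deriv p holomorphic_on ball 0 1" "deriv (deriv p) holomorphic_on ball 0 1"
      using that by (auto intro!: holomorphic_deriv)
    have "continuous_on {w. Re w < 0} (\<lambda>w. p (exp w))" if "p holomorphic_on ball 0 1" for p
      by (rule continuous_on_compose2[OF holomorphic_on_imp_continuous_on[OF that]])
        (auto intro!: continuous_intros)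
    note [continuous_intros] = this[OF that] this[OF p'(1)] this[OF p'(2)]
    show "continuous_on {w. Re w < 0} (X p)" "continuous_on {w. Re w < 0} (X1 p)"
      "continuous_on {w. Re w < 0} (X2 p)"
      unfolding X_def X1_def X2_def by (intro continuous_intros)+
  qed
  \<comment> \<open>A complex derivative f' is the partial derivative in s, and i f' is the one in
    t.\<close>
  have real_parts:
    "((\<lambda>s. Re (f (Complex s t))) has_real_derivative Re f') (at s)"
    "((\<lambda>s. Im (f (Complex s t))) has_real_derivative Im f') (at s)"
    "((\<lambda>t. Re (f (Complex s t))) has_real_derivative Re (\<i> * f')) (at t)"
    "((\<lambda>t. Im (f (Complex s t))) has_real_derivative Im (\<i> * f')) (at t)"
    if "(f has_field_derivative f') (at (Complex s t))" for f f' s t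
  proof -
    have "((\<lambda>s. Complex s t) has_vector_derivative 1) (at s)"
      unfolding Complex_eq by (auto intro!: derivative_eq_intros)
    from field_vector_diff_chain_at[OF this that]
    have 1: "((\<lambda>s. f (Complex s t)) has_vector_derivative f') (at s)" by (simp add: o_def)
    have "((\<lambda>t. Complex s t) has_vector_derivative \<i>) (at t)"
      unfolding Complex_eq by (auto intro!: derivative_eq_intros)
    from field_vector_diff_chain_at[OF this that]
    have 2: "((\<lambda>t. f (Complex s t)) has_vector_derivative \<i> * f') (at t)" by (simp add: o_def)
    show "((\<lambda>s. Re (f (Complex s t))) has_real_derivative Re f') (at s)"
      "((\<lambda>s. Im (f (Complex s t))) has_real_derivative Im f') (at s)"
      "((\<lambda>t. Re (f (Complex s t))) has_real_derivative Re (\<i> * f')) (at t)"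
      "((\<lambda>t. Im (f (Complex s t))) has_real_derivative Im (\<i> * f')) (at t)"
      using bounded_linear.has_vector_derivative[OF bounded_linear_Re 1]
        bounded_linear.has_vector_derivative[OF bounded_linear_Im 1]
        bounded_linear.has_vector_derivative[OF bounded_linear_Re 2]
        bounded_linear.has_vector_derivative[OF bounded_linear_Im 2]
      by (auto simp: has_real_derivative_iff_has_vector_derivative)
  qed
  have posX: "Re (X p w) > 0" if "Re w < 0" for w
    using pos[of "exp w"] that by (simp add: X_def)
  define F where "F w = llog_norm c d (Re (X p w)) (Im (X q w))" for w
  define F1 where "F1 w = llog_norm' c d (Re (X p w)) (Im (X q w)) (Re (X1 p w)) (Im (X1 q w))" for w
  define F2 where "F2 w = llog_norm'' c d (Re (X p w)) (Im (X q w)) (Re (X1 p w)) (Im (X1 q w))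
    (Re (X2 p w)) (Im (X2 q w))" for w
  define G1 where "G1 w = llog_norm' c d (Re (X p w)) (Im (X q w)) (Re (\<i> * X1 p w)) (Im (\<i> * X1 q w))" for w
  define G2 where "G2 w = llog_norm'' c d (Re (X p w)) (Im (X q w)) (Re (\<i> * X1 p w)) (Im (\<i> * X1 q w))
    (- Re (X2 p w)) (- Im (X2 q w))" for w
  define M where "M s = integral {0..2*pi} (\<lambda>t. F (Complex s t))" for s
  have M_eq: "M s = m (exp s)" for s
    by (simp add: M_def m_def F_def X_def exp_eq_polar)
  have contF: "continuous_on {w. Re w < 0} F" "continuous_on {w. Re w < 0} F1" "continuous_on {w. Re w < 0} F2"
  proof -
    have nz: "(Re (X p w))\<^sup>2 + (Im (X q w))\<^sup>2 \<noteq> 0" "Re (X p w) \<noteq> 0" "Re (X p w) > 0" if "Re w < 0" for w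
      using posX[OF that] by (auto simp: sum_power2_eq_zero_iff)
    show "continuous_on {w. Re w < 0} F" "continuous_on {w. Re w < 0} F1" "continuous_on {w. Re w < 0} F2"
      unfolding F_def F1_def F2_def llog_norm_def llog_norm'_def llog_norm''_def
      by (intro continuous_intros contX holo; use nz in \<open>simp; fail\<close>)+
  qed
  have disc: "norm (of_real r * cis t) < 1" if "0 \<le> r" "r < 1" for r t
    using that by (simp add: norm_mult)
  have contm: "continuous_on {0..<1} m"
  proof -
    have nz: "(Re (p z))\<^sup>2 + (Im (q z))\<^sup>2 \<noteq> 0" "Re (p z) \<noteq> 0" "Re (p z) > 0" if "z \<in> ball 0 1" for z
      using pos[of z] that by (auto simp: sum_power2_eq_zero_iff)
    have "continuous_on (ball 0 1) (\<lambda>z. llog_norm c d (Re (p z)) (Im (q z)))"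
      unfolding llog_norm_def
      by (intro continuous_intros holomorphic_on_imp_continuous_on holo; use nz in \<open>simp; fail\<close>)
    then have "continuous_on ({0..<1} \<times> cbox 0 (2*pi))
        (\<lambda>(r, t). llog_norm c d (Re (p (of_real r * cis t))) (Im (q (of_real r * cis t))))"
      unfolding split_def
      by (rule continuous_on_compose2) (auto intro!: continuous_intros disc)
    from integral_continuous_on_param[OF this] show ?thesis by (simp add: m_def)
  qed
  \<comment> \<open>The means are continuous up to radius 0, hence bounded on a compact range of
    radii; this range covers all s \<le> -1.\<close>
  obtain B where B: "\<And>r. 0 \<le> r \<Longrightarrow> r \<le> exp (-1) \<Longrightarrow> m r \<le> B"
  proof -
    have "exp (-1 :: real) < 1" by simp
    then have "compact (m ` {0..exp (-1)})"
      by (intro compact_continuous_image continuous_on_subset[OF contm]) (auto simp del: exp_less_one_iff)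
    then have "bdd_above (m ` {0..exp (-1)})"
      by (intro bounded_imp_bdd_above compact_imp_bounded)
    then show ?thesis using that by (auto simp: bdd_above_def) (meson atLeastAtMost_iff)
  qed
  have M_mono: "M s \<le> M t" if "s \<le> t" "t < 0" for s t
    unfolding M_def
  proof (rule halfplane_mean_mono[where ?F1.0 = F1 and ?F2.0 = F2 and ?G1.0 = G1 and ?G2.0 = G2
        and a = "-1" and B = B])
    fix s t :: real assume s: "s < 0"
    then have w: "Re (Complex s t) < 0" by simp
    note DP = DX[OF holo(1) w] DX[OF holo(2) w] DX1[OF holo(1) w] DX1[OF holo(2) w]
    have P: "0 < Re (X p (Complex s t))" using s by (intro posX) simp
    show "((\<lambda>s. F (Complex s t)) has_real_derivative F1 (Complex s t)) (at s)"
      unfolding F_def F1_def by (rule llog_norm_deriv real_parts DP P)+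
    show "((\<lambda>s. F1 (Complex s t)) has_real_derivative F2 (Complex s t)) (at s)"
      unfolding F1_def F2_def by (rule llog_norm'_deriv real_parts DP P)+
    have "((\<lambda>t. Re (\<i> * X1 p (Complex s t))) has_real_derivative - Re (X2 p (Complex s t))) (at t)"
         "((\<lambda>t. Im (\<i> * X1 q (Complex s t))) has_real_derivative - Im (X2 q (Complex s t))) (at t)"
      using real_parts(3)[OF DERIV_cmult[OF DP(3), of \<i>]] real_parts(4)[OF DERIV_cmult[OF DP(4), of \<i>]]
      by simp_all
    then show "((\<lambda>t. G1 (Complex s t)) has_real_derivative G2 (Complex s t)) (at t)"
      unfolding G1_def G2_def by (intro llog_norm'_deriv real_parts DP P)
  next
    fix s :: real
    have "exp (Complex s (2*pi)) = exp (Complex s 0)"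
      by (simp add: exp_eq_polar)
    then show "G1 (Complex s (2*pi)) = G1 (Complex s 0)"
      by (simp add: G1_def X_def X1_def)
  next
    fix w :: complex assume w: "Re w < 0"
    define z where "z = exp w"
    have "norm z < 1" using w by (simp add: z_def)
    \<comment> \<open>Both \<open>X1 p\<close> and \<open>X1 q\<close> carry a factor z, so the
      Laplacian in w is |z|^2 times the one in z.\<close>
    note L = mult_right_mono[OF laplacian[OF this], of "(norm z)\<^sup>2"]
    have "F2 w + G2 w = c * (norm (X1 p w))\<^sup>2 / Re (X p w)
      - d * (norm (of_real (Re (X p w)) * X1 q w - \<i> * of_real (Im (X q w)) * X1 p w))\<^sup>2
        / sqrt ((Re (X p w))\<^sup>2 + (Im (X q w))\<^sup>2) ^ 3"
      unfolding F2_def G2_def by (rule llog_norm''_laplacian) (rule posX[OF w])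
    also have "of_real (Re (X p w)) * X1 q w - \<i> * of_real (Im (X q w)) * X1 p w
      = (of_real (Re (p z)) * deriv q z - \<i> * of_real (Im (q z)) * deriv p z) * z"
      by (simp add: X_def X1_def z_def algebra_simps)
    finally show "0 \<le> F2 w + G2 w" using L
      by (simp add: X_def X1_def z_def[symmetric] norm_mult power_mult_distrib mult.assoc)
  next
    fix s :: real assume "s \<le> -1"
    then show "integral {0..2*pi} (\<lambda>t. F (Complex s t)) \<le> B"
      using B[of "exp s"] M_eq[of s] by (simp add: M_def)
  qed (use that contF in auto)
  have m_mono: "m r \<le> m R" if "0 < r" "r \<le> R" "R < 1" for r R
    using M_mono[of "ln r" "ln R"] that by (simp add: M_eq)
  \<comment> \<open>Radius 0 is not a value of exp, so this case uses right-continuity of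
    \<open>m\<close> at 0.\<close>
  have "m 0 \<le> m R" if "0 < R" "R < 1" for R
  proof (rule tendsto_upperbound)
    have "continuous_on {0..1/2} m"
      by (rule continuous_on_subset[OF contm]) auto
    then have "(m \<longlongrightarrow> m 0) (at 0 within {0..1/2})"
      by (simp add: continuous_on_def)
    then show "(m \<longlongrightarrow> m 0) (at_right 0)"
      by (simp add: at_within_Icc_at_right)
    show "\<forall>\<^sub>F r in at_right 0. m r \<le> m R"
      using eventually_at_right_less[of 0] eventually_at_right_real[OF that(1)]
      by eventually_elim (use that m_mono in auto)
  qed simp
  with m_mono le show ?thesis by (cases "r = 0"; cases "R = 0") auto
qed

section \<open>Limits of monotone means and locality of harmonicity\<close>

lemma continuous_on_circle:
  fixes \<phi> :: "complex \<Rightarrow> real"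
  assumes "continuous_on (ball 0 1) \<phi>" "0 \<le> r" "r < 1"
  shows "continuous_on {0..2*pi} (\<lambda>t. \<phi> (of_real r * cis t))"
  by (rule continuous_on_compose2[OF assms(1)]) (use assms in \<open>auto intro!: continuous_intros simp: norm_mult\<close>)

lemma tendsto_at_left_mono_bounded:
  fixes \<phi> :: "real \<Rightarrow> real"
  assumes mono: "\<And>r s. a < r \<Longrightarrow> r \<le> s \<Longrightarrow> s < b \<Longrightarrow> \<phi> r \<le> \<phi> s"
    and bound: "\<And>r. a < r \<Longrightarrow> r < b \<Longrightarrow> \<phi> r \<le> B" and "a < b"
  shows "\<exists>L. (\<phi> \<longlongrightarrow> L) (at_left b)"
proof -
  define L where "L = (SUP r\<in>{a<..<b}. \<phi> r)"
  have bdd: "bdd_above (\<phi> ` {a<..<b})" using bound by (intro bdd_aboveI2) auto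
  have le: "\<phi> r \<le> L" if "a < r" "r < b" for r
    unfolding L_def by (rule cSUP_upper[OF _ bdd]) (use that in simp)
  have "(\<phi> \<longlongrightarrow> L) (at_left b)"
  proof (rule order_tendstoI)
    fix x assume "x < L"
    then obtain r where r: "a < r" "r < b" "x < \<phi> r"
      unfolding L_def using less_cSUP_iff[of "{a<..<b}" \<phi> x] bdd \<open>a < b\<close> by auto
    show "\<forall>\<^sub>F y in at_left b. x < \<phi> y"
      using eventually_at_left_real[OF r(2)]
      by eventually_elim (use r mono in \<open>force intro: less_le_trans\<close>)
  next
    fix x assume "L < x"
    then show "\<forall>\<^sub>F y in at_left b. \<phi> y < x"
      using eventually_at_left_real[OF \<open>a < b\<close>]
      by (auto elim!: eventually_mono intro: le_less_trans[OF le])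
  qed
  then show ?thesis ..
qed

text \<open>Partial derivatives at a point of an open set depend only on nearby values. This matters
  because \<open>v\<close> is known to be the imaginary part of \<open>f\<close> only on the disc
  and is arbitrary outside it.\<close>

lemma partial_cong:
  assumes "open S" "\<And>z. z \<in> S \<Longrightarrow> u z = w z" "z \<in> S"
  shows "partial_x u z = partial_x w z" "partial_y u z = partial_y w z"
    and "(\<lambda>t::real. u (z + of_real t)) field_differentiable at 0 \<longleftrightarrow>
         (\<lambda>t::real. w (z + of_real t)) field_differentiable at 0"
    and "(\<lambda>t::real. u (z + \<i> * of_real t)) field_differentiable at 0 \<longleftrightarrow>
         (\<lambda>t::real. w (z + \<i> * of_real t)) field_differentiable at 0"
proof -
  have ev: "\<forall>\<^sub>F t::real in nhds 0. u (z + e * of_real t) = w (z + e * of_real t)" for e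
  proof -
    have "((\<lambda>t::real. z + e * of_real t) \<longlongrightarrow> z + e * of_real 0) (nhds 0)"
      by (intro tendsto_intros filterlim_ident)
    then have "\<forall>\<^sub>F t::real in nhds 0. z + e * of_real t \<in> S"
      using assms(1,3) by (intro topological_tendstoD) auto
    then show ?thesis by eventually_elim (simp add: assms(2))
  qed
  show "partial_x u z = partial_x w z" "partial_y u z = partial_y w z"
    unfolding partial_x_def partial_y_def
    using ev[of 1] ev[of \<i>] by (auto intro!: deriv_cong_ev)
  show "(\<lambda>t::real. u (z + of_real t)) field_differentiable at 0 \<longleftrightarrow>
         (\<lambda>t::real. w (z + of_real t)) field_differentiable at 0"
    "(\<lambda>t::real. u (z + \<i> * of_real t)) field_differentiable at 0 \<longleftrightarrow>
         (\<lambda>t::real. w (z + \<i> * of_real t)) field_differentiable at 0"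
    unfolding field_differentiable_def
    using DERIV_cong_ev[OF refl ev[of 1] refl] DERIV_cong_ev[OF refl ev[of \<i>] refl] by simp_all
qed

lemma C1_on_cong:
  assumes "open S" "\<And>z. z \<in> S \<Longrightarrow> u z = w z"
  shows "C1_on S u \<longleftrightarrow> C1_on S w"
  unfolding C1_on_def using partial_cong[of S u w, OF assms]
  by (simp cong: continuous_on_cong)

lemma real_harmonic_on_cong:
  assumes "open S" "\<And>z. z \<in> S \<Longrightarrow> u z = w z"
  shows "real_harmonic_on S u \<longleftrightarrow> real_harmonic_on S w"
proof -
  note 1 = partial_cong(1,2)[of S u w, OF assms]
  \<comment> \<open>The first partials agree on all of \<open>S\<close>, so the same locality yields
    agreement of the pure second partials.\<close>
  note 2 = partial_cong(1)[OF assms(1) 1(1)] partial_cong(2)[OF assms(1) 1(2)]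
  show ?thesis unfolding real_harmonic_on_def C2_on_def
    using C1_on_cong[OF assms] C1_on_cong[OF assms(1) 1(1)] C1_on_cong[OF assms(1) 1(2)] 2 by simp
qed

lemma real_harmonic_on_zero: "real_harmonic_on S (\<lambda>_. 0)"
proof -
  have "partial_x (\<lambda>_. 0) = (\<lambda>_. 0)" "partial_y (\<lambda>_. 0) = (\<lambda>_. 0)"
    by (simp_all add: partial_x_def partial_y_def fun_eq_iff)
  then show ?thesis by (simp add: real_harmonic_on_def C2_on_def C1_on_def)
qed

section \<open>Pointwise consequences of quasiregularity\<close>

text \<open>Where h' is nonzero, \<open>remove_sings\<close> leaves the quotient unchanged and the
  bound can be multiplied out. The zeros of h' are isolated because h' does not vanish identically,
  so continuity carries the bound across them. The division-free form avoids a case split at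
  critical points later.\<close>

lemma norm_deriv_le_of_dilatation:
  assumes h: "h holomorphic_on unit_disc" and g: "g holomorphic_on unit_disc"
    and nonconst: "\<exists>z\<in>unit_disc. deriv h z \<noteq> 0"
    and dil: "\<And>z. z \<in> unit_disc \<Longrightarrow> norm (complex_dilatation h g z) \<le> k"
    and z: "z \<in> unit_disc"
  shows "norm (deriv g z) \<le> k * norm (deriv h z)"
proof -
  have h': "deriv h holomorphic_on unit_disc" and g': "deriv g holomorphic_on unit_disc"
    using h g by (auto intro: holomorphic_deriv)
  have off_zeros: "norm (deriv g w) \<le> k * norm (deriv h w)" if "w \<in> unit_disc" "deriv h w \<noteq> 0" for w
  proof -
    have "(\<lambda>z. deriv g z / deriv h z) analytic_on {w}"
      using that h' g' by (intro analytic_on_divide analytic_on_subset[OF analytic_on_open[THEN iffD2]]) auto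
    then have "complex_dilatation h g w = deriv g w / deriv h w"
      by (simp add: complex_dilatation_def)
    then show ?thesis using dil[OF that(1)] that(2) by (simp add: norm_divide pos_divide_le_eq)
  qed
  obtain \<beta> where \<beta>: "\<beta> \<in> unit_disc" "deriv h \<beta> \<noteq> 0" using nonconst by blast
  have ev: "\<forall>\<^sub>F w in at z. deriv h w \<noteq> 0 \<and> w \<in> unit_disc"
    by (rule non_zero_neighbour_alt[OF h' _ _ z \<beta>]) auto
  have cont: "isCont (deriv h) z" "isCont (deriv g) z"
    using holomorphic_on_imp_continuous_on[OF h'] holomorphic_on_imp_continuous_on[OF g'] z
    by (simp_all only: continuous_on_eq_continuous_at[OF open_ball])
  show ?thesis
  proof (rule tendsto_le[of "at z"])
    show "((\<lambda>w. k * norm (deriv h w)) \<longlongrightarrow> k * norm (deriv h z)) (at z)"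
      "((\<lambda>w. norm (deriv g w)) \<longlongrightarrow> norm (deriv g z)) (at z)"
      using cont by (auto intro!: tendsto_intros simp: isCont_def)
    show "\<forall>\<^sub>F w in at z. norm (deriv g w) \<le> k * norm (deriv h w)"
      using ev by eventually_elim (use off_zeros in auto)
  qed simp
qed

text \<open>With F = a + i b the left-hand quantity is conj(F) A - F B, of modulus at most |F| (|A|
  + |B|). The dilatation bound rearranges to |A| + |B| \<le> K (|A| - |B|), and |A| - |B| \<le> |A +
  B|. In use, \<open>A\<close> and \<open>B\<close> are h' and g' up to a common sign.\<close>

lemma norm_gradient_le:
  fixes A B :: complex and a b K :: real
  assumes "K \<ge> 1" "norm B \<le> (K - 1) / (K + 1) * norm A"
  shows "norm (of_real a * (A - B) - \<i> * of_real b * (A + B)) \<le> K * sqrt (a\<^sup>2 + b\<^sup>2) * norm (A + B)"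
proof -
  define F where "F = Complex a b"
  have F: "norm F = sqrt (a\<^sup>2 + b\<^sup>2)" by (simp add: F_def cmod_def)
  have "of_real a * (A - B) - \<i> * of_real b * (A + B) = cnj F * A - F * B"
    by (simp add: F_def complex_eq_iff algebra_simps)
  then have le: "norm (of_real a * (A - B) - \<i> * of_real b * (A + B)) \<le> norm F * (norm A + norm B)"
    using norm_triangle_ineq4[of "cnj F * A" "F * B"] by (simp add: norm_mult distrib_left)
  have "(K + 1) * norm B \<le> (K - 1) * norm A"
    using assms by (simp add: field_simps)
  then have "norm A + norm B \<le> K * (norm A - norm B)" by (simp add: algebra_simps)
  also have "\<dots> \<le> K * norm (A + B)"
    using assms(1) norm_diff_ineq[of A B] by (intro mult_left_mono) auto
  finally have "norm A + norm B \<le> K * norm (A + B)" .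
  then have "norm F * (norm A + norm B) \<le> norm F * (K * norm (A + B))"
    by (intro mult_left_mono) auto
  with le show ?thesis by (simp add: F mult_ac)
qed

text \<open>The sign of \<open>u\<close> is absorbed into \<open>p\<close> and \<open>q\<close>, which unifies the cases \<open>u \<ge> 1\<close> and \<open>u \<le> -1\<close>.\<close>

lemma quasiregular_pair:
  assumes "K \<ge> 1" and "harmonic_quasiregular K f"
    and f: "\<And>z. z \<in> unit_disc \<Longrightarrow> f z = Complex (u z) (v z)"
    and sign: "(\<forall>z\<in>unit_disc. u z \<ge> 1) \<or> (\<forall>z\<in>unit_disc. u z \<le> -1)"
  obtains p q where "p holomorphic_on unit_disc" "q holomorphic_on unit_disc"
    "\<And>z. z \<in> unit_disc \<Longrightarrow> Re (p z) = \<bar>u z\<bar>"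
    "\<And>z. z \<in> unit_disc \<Longrightarrow> \<bar>Im (q z)\<bar> = \<bar>v z\<bar>"
    "\<And>z. z \<in> unit_disc \<Longrightarrow>
      norm (of_real (Re (p z)) * deriv q z - \<i> * of_real (Im (q z)) * deriv p z)
        \<le> K * sqrt ((Re (p z))\<^sup>2 + (Im (q z))\<^sup>2) * norm (deriv p z)"
proof -
  obtain h g where hg: "canonical_decomposition f h g" "sense_preserving h g"
    "\<And>z. z \<in> unit_disc \<Longrightarrow> norm (complex_dilatation h g z) \<le> (K - 1) / (K + 1)"
    using assms(2) unfolding harmonic_quasiregular_def by blast
  have holo: "h holomorphic_on unit_disc" "g holomorphic_on unit_disc"
    and fhg: "\<And>z. z \<in> unit_disc \<Longrightarrow> f z = h z + cnj (g z)"
    using hg(1) by (auto simp: canonical_decomposition_def)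
  have dil: "norm (deriv g z) \<le> (K - 1) / (K + 1) * norm (deriv h z)" if "z \<in> unit_disc" for z
    using hg(2) by (intro norm_deriv_le_of_dilatation holo hg(3) that) (auto simp: sense_preserving_def)
  obtain \<sigma> :: real where \<sigma>: "\<sigma> = 1 \<or> \<sigma> = -1" "\<And>z. z \<in> unit_disc \<Longrightarrow> \<sigma> * u z = \<bar>u z\<bar>"
  proof (cases "\<forall>z\<in>unit_disc. u z \<ge> 1")
    case True
    then show ?thesis by (intro that[of 1]) force+
  next
    case False
    with sign show ?thesis by (intro that[of "-1"]) force+
  qed
  \<comment> \<open>Conjugating g flips the sign of its imaginary part only, so \<sigma> f has real
    part Re p and imaginary part Im q. The sign of v may change as well, which is harmless for |v|
    and |f|.\<close>
  define p where "p z = of_real \<sigma> * h z + of_real \<sigma> * g z" for z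
  define q where "q z = of_real \<sigma> * h z - of_real \<sigma> * g z" for z
  show ?thesis
  proof (rule that[of p q])
    show "p holomorphic_on unit_disc" "q holomorphic_on unit_disc"
      unfolding p_def q_def by (intro holomorphic_intros holo)+
  next
    fix z :: complex assume z: "z \<in> unit_disc"
    have uv: "u z = Re (h z) + Re (g z)" "v z = Im (h z) - Im (g z)"
      using fhg[OF z] f[OF z] by (simp_all add: complex_eq_iff)
    show "Re (p z) = \<bar>u z\<bar>"
      using \<sigma>(2)[OF z] by (simp add: p_def uv distrib_left)
    show "\<bar>Im (q z)\<bar> = \<bar>v z\<bar>"
      using \<sigma>(1) by (auto simp: q_def uv)
    note D = holomorphic_derivI[OF holo(1) open_ball z] holomorphic_derivI[OF holo(2) open_ball z]
    define A B where "A = of_real \<sigma> * deriv h z" and "B = of_real \<sigma> * deriv g z"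
    have "deriv p z = A + B" "deriv q z = A - B"
      unfolding p_def q_def A_def B_def
      by (intro DERIV_imp_deriv DERIV_add DERIV_diff DERIV_cmult D)+
    moreover have "norm B \<le> (K - 1) / (K + 1) * norm A"
      using dil[OF z] \<sigma>(1) by (auto simp: A_def B_def norm_mult)
    ultimately show "norm (of_real (Re (p z)) * deriv q z - \<i> * of_real (Im (q z)) * deriv p z)
        \<le> K * sqrt ((Re (p z))\<^sup>2 + (Im (q z))\<^sup>2) * norm (deriv p z)"
      using norm_gradient_le[OF assms(1)] by simp
  qed
qed

section \<open>Comparison of the means of |f|, |v| and u ln u\<close>

text \<open>For \<open>c = 0\<close> and \<open>d = -1\<close> the Laplacian condition holds by sign
  alone: |f| is subharmonic for any such pair, without a dilatation bound.\<close>

lemma modulus_mean_mono: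
  assumes "p holomorphic_on ball 0 1" "q holomorphic_on ball 0 1"
    and "\<And>z. norm z < 1 \<Longrightarrow> Re (p z) > 0" "0 \<le> r" "r \<le> R" "R < 1"
  shows "integral {0..2*pi} (\<lambda>t. sqrt ((Re (p (of_real r * cis t)))\<^sup>2 + (Im (q (of_real r * cis t)))\<^sup>2))
    \<le> integral {0..2*pi} (\<lambda>t. sqrt ((Re (p (of_real R * cis t)))\<^sup>2 + (Im (q (of_real R * cis t)))\<^sup>2))"
  using circle_mean_mono[OF assms(1-3) _ assms(4-6), of "-1" 0] by (simp add: llog_norm_def)

text \<open>\<open>|v|\<close> is not smooth, so it is replaced by the modulus of \<open>\<epsilon> + i v\<close>.\<close>

lemma abs_Im_mean_mono:
  assumes q: "q holomorphic_on ball 0 1" and le: "0 \<le> r" "r \<le> R" "R < 1"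
  shows "integral {0..2*pi} (\<lambda>t. \<bar>Im (q (of_real r * cis t))\<bar>)
    \<le> integral {0..2*pi} (\<lambda>t. \<bar>Im (q (of_real R * cis t))\<bar>)"
proof (rule field_le_epsilon)
  fix e :: real assume "e > 0"
  \<comment> \<open>Chosen so that the constant \<epsilon> integrates to \<open>e\<close> over the
    circle; the smooth modulus lies between |v| and |v| + \<epsilon>.\<close>
  define \<epsilon> where "\<epsilon> = e / (2 * pi)"
  have \<epsilon>: "\<epsilon> > 0" "\<epsilon> * (2 * pi) = e" using \<open>e > 0\<close> by (simp_all add: \<epsilon>_def)
  have cont: "continuous_on (ball 0 1) q" by (rule holomorphic_on_imp_continuous_on[OF q])
  have int: "(\<lambda>t. \<bar>Im (q (of_real s * cis t))\<bar>) integrable_on {0..2*pi}"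
    "(\<lambda>t. sqrt (\<epsilon>\<^sup>2 + (Im (q (of_real s * cis t)))\<^sup>2)) integrable_on {0..2*pi}"
    if "0 \<le> s" "s < 1" for s
    by (intro integrable_continuous_interval continuous_on_circle continuous_intros cont that)+
  have "integral {0..2*pi} (\<lambda>t. \<bar>Im (q (of_real r * cis t))\<bar>)
      \<le> integral {0..2*pi} (\<lambda>t. sqrt (\<epsilon>\<^sup>2 + (Im (q (of_real r * cis t)))\<^sup>2))"
    using le by (intro integral_le int) (auto intro: real_le_rsqrt)
  also have "\<dots> \<le> integral {0..2*pi} (\<lambda>t. sqrt (\<epsilon>\<^sup>2 + (Im (q (of_real R * cis t)))\<^sup>2))"
    \<comment> \<open>The constant function \<epsilon> serves as \<open>p\<close>, since its real
      part is positive.\<close>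
    using modulus_mean_mono[of "\<lambda>_. of_real \<epsilon>" q r R] q le \<epsilon> by simp
  also have "\<dots> \<le> integral {0..2*pi} (\<lambda>t. \<bar>Im (q (of_real R * cis t))\<bar> + \<epsilon>)"
  proof (intro integral_le integrable_add int integrable_const_ivl)
    show "sqrt (\<epsilon>\<^sup>2 + (Im (q (of_real R * cis t)))\<^sup>2) \<le> \<bar>Im (q (of_real R * cis t))\<bar> + \<epsilon>" for t
      using sqrt_sum_squares_le_sum_abs[of \<epsilon> "Im (q (of_real R * cis t))"] \<epsilon>(1) by simp
  qed (use le in auto)
  also have "\<dots> = integral {0..2*pi} (\<lambda>t. \<bar>Im (q (of_real R * cis t))\<bar>) + e"
    using le int(1)[of R] \<epsilon>(2) by (subst integral_add) (auto simp: mult.commute)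
  finally show "integral {0..2*pi} (\<lambda>t. \<bar>Im (q (of_real r * cis t))\<bar>)
    \<le> integral {0..2*pi} (\<lambda>t. \<bar>Im (q (of_real R * cis t))\<bar>) + e" .
qed

text \<open>The mean of K^2 u ln u - |f| over the circle is at least its value at 0. Since v(0) = 0,
  that value is K^2 u(0) ln u(0) - u(0), which accounts for the last term of the bound.\<close>

lemma modulus_mean_le_llog:
  assumes holo: "p holomorphic_on ball 0 1" "q holomorphic_on ball 0 1"
    and pos: "\<And>z. norm z < 1 \<Longrightarrow> Re (p z) > 0"
    and grad: "\<And>z. norm z < 1 \<Longrightarrow>
      norm (of_real (Re (p z)) * deriv q z - \<i> * of_real (Im (q z)) * deriv p z)
        \<le> K * sqrt ((Re (p z))\<^sup>2 + (Im (q z))\<^sup>2) * norm (deriv p z)"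
    and "Im (q 0) = 0" and r: "0 \<le> r" "r < 1"
  shows "integral {0..2*pi} (\<lambda>t. sqrt ((Re (p (of_real r * cis t)))\<^sup>2 + (Im (q (of_real r * cis t)))\<^sup>2))
    \<le> K\<^sup>2 * integral {0..2*pi} (\<lambda>t. Re (p (of_real r * cis t)) * ln (Re (p (of_real r * cis t))))
      + 2 * pi * (Re (p 0) * (1 - K\<^sup>2 * ln (Re (p 0))))"
proof -
  have lap: "1 * (norm (of_real (Re (p z)) * deriv q z - \<i> * of_real (Im (q z)) * deriv p z))\<^sup>2
        / sqrt ((Re (p z))\<^sup>2 + (Im (q z))\<^sup>2) ^ 3 \<le> K\<^sup>2 * (norm (deriv p z))\<^sup>2 / Re (p z)"
    if z: "norm z < 1" for z
  proof -
    define S where "S = sqrt ((Re (p z))\<^sup>2 + (Im (q z))\<^sup>2)"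
    have S: "Re (p z) \<le> S" "S > 0"
      using pos[OF z] real_sqrt_sum_squares_ge1[of "Re (p z)" "Im (q z)"] unfolding S_def by linarith+
    have "(norm (of_real (Re (p z)) * deriv q z - \<i> * of_real (Im (q z)) * deriv p z))\<^sup>2
        \<le> (K * S * norm (deriv p z))\<^sup>2"
      unfolding S_def using grad[OF z] by (intro power_mono) auto
    then have "(norm (of_real (Re (p z)) * deriv q z - \<i> * of_real (Im (q z)) * deriv p z))\<^sup>2 / S ^ 3
        \<le> (K * S * norm (deriv p z))\<^sup>2 / S ^ 3"
      using S by (intro divide_right_mono) auto
    also have "\<dots> = K\<^sup>2 * (norm (deriv p z))\<^sup>2 / S"
      using S by (simp add: power2_eq_square power3_eq_cube)
    \<comment> \<open>Replacing |f| by the smaller Re p in the denominator produces the Laplacian of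
      K^2 u ln u.\<close>
    also have "\<dots> \<le> K\<^sup>2 * (norm (deriv p z))\<^sup>2 / Re (p z)"
      using S pos[OF z] by (intro divide_left_mono) auto
    finally show ?thesis by (simp add: S_def)
  qed
  have cont: "continuous_on (ball 0 1) p" "continuous_on (ball 0 1) q"
    using holo by (auto intro: holomorphic_on_imp_continuous_on)
  have "(\<lambda>t. Re (p (of_real r * cis t)) * ln (Re (p (of_real r * cis t)))) integrable_on {0..2*pi}"
    "(\<lambda>t. sqrt ((Re (p (of_real r * cis t)))\<^sup>2 + (Im (q (of_real r * cis t)))\<^sup>2)) integrable_on {0..2*pi}"
    using pos by (intro integrable_continuous_interval continuous_on_circle continuous_intros cont r;
        force)+
  then have "integral {0..2*pi} (\<lambda>t. llog_norm (K\<^sup>2) 1 (Re (p (of_real r * cis t))) (Im (q (of_real r * cis t))))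
    = K\<^sup>2 * integral {0..2*pi} (\<lambda>t. Re (p (of_real r * cis t)) * ln (Re (p (of_real r * cis t))))
      - integral {0..2*pi} (\<lambda>t. sqrt ((Re (p (of_real r * cis t)))\<^sup>2 + (Im (q (of_real r * cis t)))\<^sup>2))"
    unfolding llog_norm_def by (simp add: integral_diff integrable_on_mult_right)
  with circle_mean_mono[OF holo pos lap order_refl r] \<open>Im (q 0) = 0\<close> pos[of 0]
  show ?thesis by (simp add: llog_norm_def algebra_simps)
qed

section \<open>Return from the pair \<open>p\<close>, \<open>q\<close> to \<open>f\<close> and
  \<open>v\<close>\<close>

theorem theorem1:
  fixes K :: real and f :: "complex \<Rightarrow> complex" and u v :: "complex \<Rightarrow> real"
  assumes "K \<ge> 1"
    and "harmonic_quasiregular K f"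
    and "\<forall>z\<in>unit_disc. f z = Complex (u z) (v z)"
    and "(\<forall>z\<in>unit_disc. u z \<ge> 1) \<or> (\<forall>z\<in>unit_disc. u z \<le> -1)"
    and "v 0 = 0"
    and "u \<in> h_log_h"
  shows "f \<in> hardy_harmonic 1 \<and>
    (\<forall>r\<in>{0<..<1}. integral_mean 1 r f
       \<le> K\<^sup>2 / (2 * pi) * llog_integral u r + \<bar>u 0\<bar> * (1 - K\<^sup>2 * ln \<bar>u 0\<bar>)) \<and>
    (\<lambda>z. complex_of_real (v z)) \<in> hardy_harmonic 1 \<and>
    (\<forall>r\<in>{0<..<1}. integral_mean 1 r (\<lambda>z. complex_of_real (v z))
       \<le> K\<^sup>2 / (2 * pi) * llog_integral u r + \<bar>u 0\<bar> * (1 - K\<^sup>2 * ln \<bar>u 0\<bar>))"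
proof -
  have f: "f z = Complex (u z) (v z)" if "z \<in> unit_disc" for z using assms(3) that by blast
  obtain p q where holo: "p holomorphic_on unit_disc" "q holomorphic_on unit_disc"
    and p: "\<And>z. z \<in> unit_disc \<Longrightarrow> Re (p z) = \<bar>u z\<bar>"
    and q: "\<And>z. z \<in> unit_disc \<Longrightarrow> \<bar>Im (q z)\<bar> = \<bar>v z\<bar>"
    and grad: "\<And>z. z \<in> unit_disc \<Longrightarrow>
      norm (of_real (Re (p z)) * deriv q z - \<i> * of_real (Im (q z)) * deriv p z)
        \<le> K * sqrt ((Re (p z))\<^sup>2 + (Im (q z))\<^sup>2) * norm (deriv p z)"
    using quasiregular_pair[OF assms(1,2) f assms(4)] by metis
  have p_ge1: "Re (p z) \<ge> 1" if "norm z < 1" for z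
    using p[of z] that assms(4) by force
  have pos: "Re (p z) > 0" if "norm z < 1" for z
    using p_ge1[OF that] by simp
  have disc: "of_real r * cis t \<in> unit_disc" if "0 < r" "r < 1" for r t
    using that by (simp add: norm_mult)
  have norm_f: "norm (f z) = sqrt ((Re (p z))\<^sup>2 + (Im (q z))\<^sup>2)" if "z \<in> unit_disc" for z
  proof -
    have "(Re (p z))\<^sup>2 = (u z)\<^sup>2" "(Im (q z))\<^sup>2 = (v z)\<^sup>2"
      using p[OF that] q[OF that] by (simp, metis power2_abs)
    then show ?thesis by (simp add: f[OF that] cmod_def)
  qed
  define mean_mod where
    "mean_mod r = integral {0..2*pi} (\<lambda>t. sqrt ((Re (p (of_real r * cis t)))\<^sup>2 + (Im (q (of_real r * cis t)))\<^sup>2))" for r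
  define mean_abs_v where "mean_abs_v r = integral {0..2*pi} (\<lambda>t. \<bar>Im (q (of_real r * cis t))\<bar>)" for r
  have mean_f: "integral_mean 1 r f = mean_mod r / (2 * pi)"
    and mean_v: "integral_mean 1 r (\<lambda>z. complex_of_real (v z)) = mean_abs_v r / (2 * pi)"
    and llog: "llog_integral u r = integral {0..2*pi} (\<lambda>t. Re (p (of_real r * cis t)) * ln (Re (p (of_real r * cis t))))"
    and mean_abs_v_le: "mean_abs_v r \<le> mean_mod r"
    if r: "0 < r" "r < 1" for r
  proof -
    have integrable: "(\<lambda>t. \<bar>Im (q (of_real r * cis t))\<bar>) integrable_on {0..2*pi}"
      "(\<lambda>t. sqrt ((Re (p (of_real r * cis t)))\<^sup>2 + (Im (q (of_real r * cis t)))\<^sup>2)) integrable_on {0..2*pi}"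
      using r by (intro integrable_continuous_interval continuous_on_circle continuous_intros
          holomorphic_on_imp_continuous_on holo; simp)+
    \<comment> \<open>Nonnegativity allows the outer exponent \<open>1 / p = 1\<close> in
      \<open>integral_mean\<close> to be dropped.\<close>
    then have nonneg: "0 \<le> mean_mod r" "0 \<le> mean_abs_v r"
      unfolding mean_mod_def mean_abs_v_def by (auto intro: integral_nonneg)
    show "integral_mean 1 r f = mean_mod r / (2 * pi)"
      using nonneg(1) norm_f[OF disc[OF r]] by (simp add: integral_mean_def mean_mod_def)
    show "integral_mean 1 r (\<lambda>z. complex_of_real (v z)) = mean_abs_v r / (2 * pi)"
      using nonneg(2) q[OF disc[OF r]] by (simp add: integral_mean_def mean_abs_v_def)
    \<comment> \<open>Here |u| \<ge> 1 is used: the logarithm is nonnegative and equals its positive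
      part.\<close>
    have "log_plus (Re (p (of_real r * cis t))) = ln (Re (p (of_real r * cis t)))" for t
      using p_ge1[of "of_real r * cis t"] disc[OF r, of t] by (simp add: log_plus_def)
    then show "llog_integral u r = integral {0..2*pi} (\<lambda>t. Re (p (of_real r * cis t)) * ln (Re (p (of_real r * cis t))))"
      using p[OF disc[OF r]] by (simp add: llog_integral_def)
    show "mean_abs_v r \<le> mean_mod r"
      unfolding mean_abs_v_def mean_mod_def by (intro integral_le integrable) simp
  qed
  have bound: "mean_mod r / (2 * pi) \<le> K\<^sup>2 / (2 * pi) * llog_integral u r + \<bar>u 0\<bar> * (1 - K\<^sup>2 * ln \<bar>u 0\<bar>)"
    if r: "0 < r" "r < 1" for r
  proof -
    have "Im (q 0) = 0" using q[of 0] assms(5) by simp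
    from modulus_mean_le_llog[OF holo pos grad this, of r] r p[of 0] llog[OF r]
    have "mean_mod r \<le> K\<^sup>2 * llog_integral u r + 2 * pi * (\<bar>u 0\<bar> * (1 - K\<^sup>2 * ln \<bar>u 0\<bar>))"
      by (simp add: mean_mod_def)
    from divide_right_mono[OF this, of "2 * pi"] show ?thesis
      by (simp add: add_divide_distrib)
  qed
  have mean_abs_v_div_le: "mean_abs_v r / (2 * pi) \<le> mean_mod r / (2 * pi)" if "0 < r" "r < 1" for r
    using mean_abs_v_le[OF that] by (intro divide_right_mono) auto
  \<comment> \<open>Membership in \<open>h_log_h\<close> bounds the right-hand side of
    \<open>bound\<close> uniformly in \<open>r\<close>, as needed for convergence of the increasing
    means.\<close>
  obtain C where C: "\<And>r. 0 < r \<Longrightarrow> r < 1 \<Longrightarrow> mean_mod r / (2 * pi) \<le> C"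
  proof -
    obtain C0 where C0: "\<And>r. 0 < r \<Longrightarrow> r < 1 \<Longrightarrow> \<bar>llog_integral u r\<bar> \<le> C0"
      using assms(6) unfolding h_log_h_def bounded_iff by force
    show ?thesis
    proof (rule that)
      fix r :: real assume r: "0 < r" "r < 1"
      have "K\<^sup>2 / (2 * pi) * llog_integral u r \<le> K\<^sup>2 / (2 * pi) * C0"
        using C0[OF r] by (intro mult_left_mono) auto
      with bound[OF r] show "mean_mod r / (2 * pi) \<le> K\<^sup>2 / (2 * pi) * C0 + \<bar>u 0\<bar> * (1 - K\<^sup>2 * ln \<bar>u 0\<bar>)"
        by simp
    qed
  qed
  have near: "\<forall>\<^sub>F r in at_left (1::real). 0 < r \<and> r < 1"
    using eventually_at_left_real[of 0 "1::real"] by (auto elim: eventually_mono)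
  have limit_f: "\<exists>L. ((\<lambda>r. mean_mod r / (2 * pi)) \<longlongrightarrow> L) (at_left 1)"
  proof (rule tendsto_at_left_mono_bounded[OF _ C])
    show "mean_mod r / (2 * pi) \<le> mean_mod s / (2 * pi)" if "0 < r" "r \<le> s" "s < 1" for r s
      unfolding mean_mod_def using that
      by (intro divide_right_mono modulus_mean_mono holo pos) auto
  qed auto
  \<comment> \<open>The formula for the mean is available only for radii in (0, 1), so the limit is
    transferred along eventual equality.\<close>
  have ev_f: "\<forall>\<^sub>F r in at_left 1. mean_mod r / (2 * pi) = integral_mean 1 r f"
    using near by eventually_elim (simp add: mean_f)
  have lim_f: "\<exists>L. ((\<lambda>r. integral_mean 1 r f) \<longlongrightarrow> L) (at_left 1)"
    using limit_f unfolding tendsto_cong[OF ev_f] .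
  have limit_v: "\<exists>L. ((\<lambda>r. mean_abs_v r / (2 * pi)) \<longlongrightarrow> L) (at_left 1)"
  proof (rule tendsto_at_left_mono_bounded[OF _ order_trans[OF mean_abs_v_div_le C]])
    show "mean_abs_v r / (2 * pi) \<le> mean_abs_v s / (2 * pi)" if "0 < r" "r \<le> s" "s < 1" for r s
      unfolding mean_abs_v_def using that
      by (intro divide_right_mono abs_Im_mean_mono holo) auto
  qed auto
  have ev_v: "\<forall>\<^sub>F r in at_left 1. mean_abs_v r / (2 * pi) = integral_mean 1 r (\<lambda>z. complex_of_real (v z))"
    using near by eventually_elim (simp add: mean_v)
  have lim_v: "\<exists>L. ((\<lambda>r. integral_mean 1 r (\<lambda>z. complex_of_real (v z))) \<longlongrightarrow> L) (at_left 1)"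
    using limit_v unfolding tendsto_cong[OF ev_v] .
  have harm_f: "harmonic_on unit_disc f"
    using assms(2) by (simp add: harmonic_quasiregular_def)
  then have "real_harmonic_on unit_disc v"
    using real_harmonic_on_cong[of unit_disc "\<lambda>z. Im (f z)" v] f by (simp add: harmonic_on_def)
  then have harm_v: "harmonic_on unit_disc (\<lambda>z. complex_of_real (v z))"
    by (simp add: harmonic_on_def real_harmonic_on_zero)
  show ?thesis
    using harm_f harm_v lim_f lim_v bound order_trans[OF mean_abs_v_div_le bound]
    by (auto simp: hardy_harmonic_def mean_f mean_v)
qed

end
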